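(* Let $f:\mathbb R^n\to[0,\infty)$, $n\ge2$, be an $L_p$-nested function and let $\mathcal I$ be the set of all multi-indices denoting the inner nodes of the tree associated with $f$ (including the root). For $R>0$, the volume $\mathcal V_f(R)$ and the surface $\mathcal S_f(R)$ of the $L_p$-nested sphere of radius $R$ are given by $$\mathcal V_f(R)=\frac{R^n2^n}{n}\prod_{I\in\mathcal I}\frac{1}{p_I^{\ell_I-1}}\prod_{k=1}^{\ell_I-1}B\left[\frac{\sum_{i=1}^k n_{I,i}}{p_I},\frac{n_{I,k+1}}{p_I}\right]=\frac{R^n2^n}{n}\prod_{I\in\mathcal I}\frac{\prod_{k=1}^{\ell_I}\Gamma\left[\frac{n_{I,k}}{p_I}\right]}{p_I^{\ell_I-1}\,\Gamma\left[\frac{n_I}{p_I}\right]},$$ $$\mathcal S_f(R)=R^{n-1}2^n\prod_{I\in\mathcal I}\frac{1}{p_I^{\ell_I-1}}\prod_{k=1}^{\ell_I-1}B\left[\frac{\sum_{i=1}^k n_{I,i}}{p_I},\frac{n_{I,k+1}}{p_I}\right]=R^{n-1}2^n\prod_{I\in\mathcal I}\frac{\prod_{k=1}^{\ell_I}\Gamma\left[\frac{n_{I,k}}{p_I}\right]}{p_I^{\ell_I-1}\,\Gamma\left[\frac{n_I}{p_I}\right]},$$ where $B[a,b]=\Gamma[a]\Gamma[b]/\Gamma[a+b]$ is the beta function.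
   Context: **$L_p$-nested functions.** An $L_p$-nested function $f:\mathbb R^n\to[0,\infty)$ is given by a finite rooted ordered tree whose $n$ leaves, read from left to right, correspond to the coordinates $x_1,\dots,x_n$; every inner node $I$ has $\ell_I\ge 2$ children, denoted $(I,1),\dots,(I,\ell_I)$, and carries an exponent $p_I>0$. Nodes are denoted by multi-indices describing the path from the root; the root is $\emptyset$. For a node $I$, $\boldsymbol x_I$ denotes the coordinates at leaves in the subtree under $I$, and $n_I$ is the number of those leaves ($n_I=1$ if $I$ is a leaf). Put $f_I(\boldsymbol x_I)=|x_i|$ if $I$ is the leaf of $x_i$, and $f_I(\boldsymbol x_I)=\left(\sum_{k=1}^{\ell_I} f_{I,k}(\boldsymbol x_{I,k})^{p_I}\right)^{1/p_I}$ if $I$ is an inner node; $f=f_\emptyset$. **Volume and surface.** $\mathcal V_f(R)$ is the Lebesgue measure of $\{\boldsymbol x\in\mathbb R^n: f(\boldsymbol x)\le R\}$, and the surface is $\mathcal S_f(R)=\frac{d}{dR}\mathcal V_f(R)$. *)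

theory Defs
  imports "HOL-Analysis.Analysis"
begin

datatype lp_tree = Leaf | Node (exponent: real) (children: "lp_tree list")
  where "children Leaf = []"

primrec wf_lp_tree :: "lp_tree \<Rightarrow> bool" where
  "wf_lp_tree Leaf = True"
| "wf_lp_tree (Node p ts) = (0 < p \<and> 2 \<le> length ts \<and> list_all wf_lp_tree ts)"

primrec n_leaves :: "lp_tree \<Rightarrow> nat" where
  "n_leaves Leaf = 1"
| "n_leaves (Node p ts) = sum_list (map n_leaves ts)"

lemma size_nth_child [termination_simp]:
  "k < length ts \<Longrightarrow> size (ts ! k) < Suc (size_list size ts)"
  using size_list_estimation'[of "ts ! k" ts "size (ts ! k)" size] by simp

text \<open>
  The coordinates of a tree with \<open>n\<close> leaves are \<open>x 1, \<dots>, x n\<close>, from left to right. The subtree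
  \<open>ts ! k\<close> is applied to the coordinates shifted by the number of leaves to the left of it,
  so that it again reads its own coordinates from index \<open>1\<close> on.
\<close>

fun lp_nested :: "lp_tree \<Rightarrow> (nat \<Rightarrow> real) \<Rightarrow> real" where
  "lp_nested Leaf x = \<bar>x 1\<bar>"
| "lp_nested (Node p ts) x =
     (\<Sum>k<length ts. lp_nested (ts ! k) (\<lambda>i. x ((\<Sum>j<k. n_leaves (ts ! j)) + i)) powr p) powr (1 / p)"

text \<open>
  A multi-index is the path from the root \<open>[]\<close>; children are numbered from \<open>1\<close>, and the \<open>k\<close>-th
  child of \<open>I\<close> is \<open>I @ [k]\<close>. Paths leaving the tree are sent to \<open>Leaf\<close>, so they never count as
  inner nodes.
\<close>

fun subtree :: "lp_tree \<Rightarrow> nat list \<Rightarrow> lp_tree" where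
  "subtree T [] = T"
| "subtree T (k # I) =
     (if k \<in> {1..length (children T)} then subtree (children T ! (k - 1)) I else Leaf)"

definition inner_nodes :: "lp_tree \<Rightarrow> nat list set" where
  "inner_nodes T = {I. subtree T I \<noteq> Leaf}"

definition node_exponent :: "lp_tree \<Rightarrow> nat list \<Rightarrow> real" where
  "node_exponent T I = exponent (subtree T I)"

definition node_arity :: "lp_tree \<Rightarrow> nat list \<Rightarrow> nat" where
  "node_arity T I = length (children (subtree T I))"

definition node_leaves :: "lp_tree \<Rightarrow> nat list \<Rightarrow> nat" where
  "node_leaves T I = n_leaves (subtree T I)"

lemma finite_inner_nodes: "finite (inner_nodes T)"
proof (induction T)
  case Leaf
  have "subtree Leaf I = Leaf" for I by (cases I) auto
  then show ?case by (simp add: inner_nodes_def)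
next
  case (Node p ts)
  have "inner_nodes (Node p ts) \<subseteq>
      insert [] (\<Union>k\<in>{1..length ts}. (#) k ` inner_nodes (ts ! (k - 1)))"
  proof
    fix I assume "I \<in> inner_nodes (Node p ts)"
    then show "I \<in> insert [] (\<Union>k\<in>{1..length ts}. (#) k ` inner_nodes (ts ! (k - 1)))"
      by (cases I) (auto simp: inner_nodes_def split: if_splits)
  qed
  moreover have "finite (inner_nodes (ts ! (k - 1)))" if "k \<in> {1..length ts}" for k
    using that by (intro Node.IH nth_mem) auto
  ultimately show ?case
    by (elim finite_subset) auto
qed

text \<open>
  \<open>\<real>\<^sup>n\<close> is the space of the \<open>n\<close>-fold product of \<open>lborel\<close>, with coordinates indexed by \<open>{1..n}\<close>.
\<close>

definition lp_volume :: "nat \<Rightarrow> ((nat \<Rightarrow> real) \<Rightarrow> real) \<Rightarrow> real \<Rightarrow> real" where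
  "lp_volume n f R =
     (let M = Pi\<^sub>M {1..n} (\<lambda>_. lborel) in measure M {x \<in> space M. f x \<le> R})"

definition lp_surface :: "nat \<Rightarrow> ((nat \<Rightarrow> real) \<Rightarrow> real) \<Rightarrow> real \<Rightarrow> real" where
  "lp_surface n f R = deriv (lp_volume n f) R"

end

theory Submission
  imports Defs
begin

text \<open>
  By homogeneity \<open>vol {f \<le> r} = r ^ n * vol {f \<le> 1}\<close>, so writing \<open>exp (- y)\<close> as the integral of
  \<open>exp (- s)\<close> over \<open>s \<ge> y\<close> and exchanging integrals gives
  \<open>\<integral> exp (- f powr p) = vol {f \<le> 1} * Gamma (n / p + 1)\<close> for every \<open>p > 0\<close>. If \<open>p\<close> is the exponent
  of the root, \<open>exp (- f powr p)\<close> is also the product of the functions \<open>exp (- f\<^sub>k powr p)\<close> of the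
  children, which depend on disjoint blocks of coordinates. Comparing the two evaluations expresses
  the volume of the unit ball through those of the children, and induction on the tree gives the
  Gamma form; the Beta form telescopes to it.
\<close>

section \<open>Lebesgue measure on finite products: dilations and blocks of coordinates\<close>

interpretation lborel_product: product_sigma_finite "\<lambda>_::nat. lborel :: real measure"
  by standard

text \<open>A product measure is determined by its values on boxes, and on a box each side
  contributes one factor \<open>c\<close> by the one-dimensional affine substitution. The
  restriction to \<open>I\<close> keeps the dilated point inside the space of the product.\<close>

lemma PiM_lborel_scale:
  fixes c :: real and I :: "nat set"
  assumes "finite I" and "0 < c"
  shows "scale_measure (ennreal (c ^ card I))
      (distr (Pi\<^sub>M I (\<lambda>_. lborel)) (Pi\<^sub>M I (\<lambda>_. lborel)) (\<lambda>x. \<lambda>i\<in>I. c * x i)) =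
    Pi\<^sub>M I (\<lambda>_. lborel)"
    (is "scale_measure _ (distr ?M _ ?s) = _")
proof (rule lborel_product.PiM_eqI)
  fix A :: "nat \<Rightarrow> real set" assume A: "\<And>i. i \<in> I \<Longrightarrow> A i \<in> sets lborel"
  have s[measurable]: "?s \<in> measurable ?M ?M"
    by measurable
  have pre: "?s -` Pi\<^sub>E I A \<inter> space ?M = Pi\<^sub>E I (\<lambda>i. (*) c -` A i)"
    by (auto simp: space_PiM PiE_iff)
  have single: "ennreal c * emeasure lborel ((*) c -` A i) = emeasure lborel (A i)"
    if "i \<in> I" for i
  proof -
    have [measurable]: "A i \<in> sets borel" using A[OF that] by simp
    have m: "(*) c -` A i \<in> sets borel"
      using measurable_sets[of "(*) c" borel borel "A i"] by simp
    have "emeasure lborel (A i) = (\<integral>\<^sup>+x. indicator (A i) x \<partial>lborel)" by simp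
    also have "\<dots> = ennreal c * (\<integral>\<^sup>+x. indicator (A i) (0 + c * x) \<partial>lborel)"
      using assms(2) by (subst nn_integral_real_affine[where c = c and t = 0]) auto
    also have "(\<integral>\<^sup>+x. indicator (A i) (0 + c * x) \<partial>lborel) =
        (\<integral>\<^sup>+x. indicator ((*) c -` A i) x \<partial>lborel)"
      by (intro nn_integral_cong) (auto simp: indicator_def)
    also have "\<dots> = emeasure lborel ((*) c -` A i)"
      using m by simp
    finally show ?thesis by simp
  qed
  have "emeasure (distr ?M ?M ?s) (Pi\<^sub>E I A) = emeasure ?M (Pi\<^sub>E I (\<lambda>i. (*) c -` A i))"
    using assms(1) A by (subst emeasure_distr) (auto simp: pre intro!: sets_PiM_I_finite)
  also have "\<dots> = (\<Prod>i\<in>I. emeasure lborel ((*) c -` A i))"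
    using A measurable_sets[of "(*) c" borel borel] assms(1)
    by (intro lborel_product.emeasure_PiM) auto
  finally show "emeasure (scale_measure (ennreal (c ^ card I)) (distr ?M ?M ?s)) (Pi\<^sub>E I A) =
      (\<Prod>i\<in>I. emeasure lborel (A i))"
    \<comment> \<open>The power \<open>c ^ card I\<close> is spread over the product as one factor
      \<open>c\<close> per coordinate, so that \<open>single\<close> applies to each factor.\<close>
    using assms(2) single prod.distrib[of "\<lambda>_. ennreal c" "\<lambda>i. emeasure lborel ((*) c -` A i)" I]
    by (simp flip: ennreal_power)
qed (use assms in auto)

lemma measurable_PiM_lborel_append:
  fixes a b :: nat
  shows "(\<lambda>(x, y). \<lambda>i\<in>{1..a + b}. if i \<le> a then x i else (y (i - a) :: real)) \<in>
    measurable (Pi\<^sub>M {1..a} (\<lambda>_. lborel) \<Otimes>\<^sub>M Pi\<^sub>M {1..b} (\<lambda>_. lborel))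
      (Pi\<^sub>M {1..a + b} (\<lambda>_. lborel))"
  unfolding case_prod_unfold
proof (rule measurable_restrict)
  fix i assume i: "i \<in> {1..a + b}"
  show "(\<lambda>z. if i \<le> a then fst z i else (snd z (i - a) :: real)) \<in>
      measurable (Pi\<^sub>M {1..a} (\<lambda>_. lborel) \<Otimes>\<^sub>M Pi\<^sub>M {1..b} (\<lambda>_. lborel)) lborel"
  proof (cases "i \<le> a")
    case True
    then show ?thesis
      using i measurable_compose[OF measurable_fst measurable_component_singleton[of i "{1..a}"]]
      by simp
  next
    case False
    then have "i - a \<in> {1..b}" using i by auto
    have "(\<lambda>z. snd z (i - a) :: real) \<in>
        measurable (Pi\<^sub>M {1..a} (\<lambda>_. lborel) \<Otimes>\<^sub>M Pi\<^sub>M {1..b} (\<lambda>_. lborel)) lborel"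
      by (rule measurable_compose[OF measurable_snd measurable_component_singleton]) fact
    then show ?thesis using False by simp
  qed
qed

text \<open>Concatenation identifies the product of the two spaces with the larger one: the preimage
  of a box is a product of two boxes, and the product of the side lengths over
  \<open>{1..a + b}\<close> splits after index \<open>a\<close>.\<close>

lemma PiM_lborel_append:
  fixes a b :: nat
  defines "M \<equiv> \<lambda>n::nat. Pi\<^sub>M {1..n} (\<lambda>_. lborel :: real measure)"
  shows "distr (M a \<Otimes>\<^sub>M M b) (M (a + b))
      (\<lambda>(x, y). \<lambda>i\<in>{1..a + b}. if i \<le> a then x i else y (i - a)) = M (a + b)"
    (is "distr _ _ ?s = _")
  unfolding M_def
proof (rule lborel_product.PiM_eqI)
  interpret Mb: sigma_finite_measure "M b"
    unfolding M_def by (rule lborel_product.sigma_finite) simp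
  fix A :: "nat \<Rightarrow> real set" assume A: "\<And>i. i \<in> {1..a + b} \<Longrightarrow> A i \<in> sets lborel"
  have s[measurable]: "?s \<in> measurable (M a \<Otimes>\<^sub>M M b) (M (a + b))"
    unfolding M_def by (rule measurable_PiM_lborel_append)
  have pre: "?s -` Pi\<^sub>E {1..a + b} A \<inter> space (M a \<Otimes>\<^sub>M M b) =
      Pi\<^sub>E {1..a} A \<times> Pi\<^sub>E {1..b} (\<lambda>i. A (a + i))"
  proof (intro set_eqI iffI; clarsimp simp: M_def space_pair_measure space_PiM PiE_iff)
    fix x y assume *: "\<forall>i\<in>{Suc 0..a + b}. (if i \<le> a then x i else y (i - a)) \<in> A i"
    have "y i \<in> A (a + i)" if "i \<in> {Suc 0..b}" for i
      using that *[rule_format, of "a + i"] by (auto split: if_splits)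
    moreover have "x i \<in> A i" if "i \<in> {Suc 0..a}" for i
      using that *[rule_format, of i] by (auto split: if_splits)
    ultimately show "(\<forall>i\<in>{Suc 0..a}. x i \<in> A i) \<and> (\<forall>i\<in>{Suc 0..b}. y i \<in> A (a + i))"
      by blast
  next
    fix x y i
    assume "\<forall>i\<in>{Suc 0..b}. y i \<in> A (a + i)" "\<not> i \<le> a" "i \<le> a + b"
    then show "y (i - a) \<in> A i"
      by (auto dest!: bspec[of _ _ "i - a"])
  qed
  have A': "Pi\<^sub>E {1..a + b} A \<in> sets (M (a + b))"
    unfolding M_def using A by (intro sets_PiM_I_finite) auto
  have "emeasure (distr (M a \<Otimes>\<^sub>M M b) (M (a + b)) ?s) (Pi\<^sub>E {1..a + b} A) =
      emeasure (M a \<Otimes>\<^sub>M M b) (Pi\<^sub>E {1..a} A \<times> Pi\<^sub>E {1..b} (\<lambda>i. A (a + i)))"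
    by (simp only: emeasure_distr[OF s A'] pre)
  also have "\<dots> = emeasure (M a) (Pi\<^sub>E {1..a} A) * emeasure (M b) (Pi\<^sub>E {1..b} (\<lambda>i. A (a + i)))"
    using A by (intro Mb.emeasure_pair_measure_Times) (auto simp: M_def intro!: sets_PiM_I_finite)
  also have "\<dots> = (\<Prod>i\<in>{1..a}. emeasure lborel (A i)) * (\<Prod>i\<in>{1..b}. emeasure lborel (A (a + i)))"
    unfolding M_def using A
    by (intro arg_cong2[where f = "(*)"] lborel_product.emeasure_PiM) auto
  also have "(\<Prod>i\<in>{1..b}. emeasure lborel (A (a + i))) = (\<Prod>i\<in>{a + 1..a + b}. emeasure lborel (A i))"
    by (rule prod.reindex_bij_witness[of _ "\<lambda>i. i - a" "\<lambda>i. a + i"]) auto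
  also have "(\<Prod>i\<in>{1..a}. emeasure lborel (A i)) * \<dots> = (\<Prod>i\<in>{1..a + b}. emeasure lborel (A i))"
    by (subst prod.ub_add_nat) auto
  finally show "emeasure (distr (Pi\<^sub>M {1..a} (\<lambda>_. lborel) \<Otimes>\<^sub>M Pi\<^sub>M {1..b} (\<lambda>_. lborel))
      (Pi\<^sub>M {1..a + b} (\<lambda>_. lborel)) ?s) (Pi\<^sub>E {1..a + b} A) =
      (\<Prod>i\<in>{1..a + b}. emeasure lborel (A i))"
    unfolding M_def .
qed simp_all

text \<open>Tonelli after concatenation. The shifted point \<open>\<lambda>i. z (a + i)\<close> is
  in general not extensional, so it may lie outside the space on which \<open>H\<close> is
  measurable. The locality assumptions \<open>Gr\<close> and \<open>Hr\<close> allow replacing such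
  arguments by their restrictions.\<close>

lemma nn_integral_PiM_lborel_append:
  fixes a b :: nat and G H :: "(nat \<Rightarrow> real) \<Rightarrow> ennreal"
  assumes G[measurable]: "G \<in> borel_measurable (Pi\<^sub>M {1..a} (\<lambda>_. lborel))"
    and H[measurable]: "H \<in> borel_measurable (Pi\<^sub>M {1..b} (\<lambda>_. lborel))"
    and Gr: "\<And>x y. (\<And>i. i \<in> {1..a} \<Longrightarrow> x i = y i) \<Longrightarrow> G x = G y"
    and Hr: "\<And>x y. (\<And>i. i \<in> {1..b} \<Longrightarrow> x i = y i) \<Longrightarrow> H x = H y"
  shows "(\<integral>\<^sup>+z. G z * H (\<lambda>i. z (a + i)) \<partial>Pi\<^sub>M {1..a + b} (\<lambda>_. lborel)) =
    (\<integral>\<^sup>+x. G x \<partial>Pi\<^sub>M {1..a} (\<lambda>_. lborel)) * (\<integral>\<^sup>+y. H y \<partial>Pi\<^sub>M {1..b} (\<lambda>_. lborel))"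
proof -
  define M where "M = (\<lambda>n::nat. Pi\<^sub>M {1..n} (\<lambda>_. lborel :: real measure))"
  have [measurable]: "G \<in> borel_measurable (M a)" "H \<in> borel_measurable (M b)"
    using G H by (simp_all add: M_def)
  interpret Mb: sigma_finite_measure "M b"
    unfolding M_def by (rule lborel_product.sigma_finite) simp
  let ?s = "\<lambda>(x, y). \<lambda>i\<in>{1..a + b}. if i \<le> a then x i else (y (i - a) :: real)"
  have s: "?s \<in> measurable (M a \<Otimes>\<^sub>M M b) (M (a + b))"
    unfolding M_def by (rule measurable_PiM_lborel_append)
  let ?F = "\<lambda>z. G z * H (\<lambda>i. z (a + i))"
  have r1: "(\<lambda>z. restrict z {1..a}) \<in> measurable (M (a + b)) (M a)"
    unfolding M_def by (rule measurable_restrict_subset) auto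
  have r2: "(\<lambda>z. \<lambda>i\<in>{1..b}. z (a + i)) \<in> measurable (M (a + b)) (M b)"
    unfolding M_def by (rule measurable_restrict) auto
  \<comment> \<open>The restricted arguments do lie in the spaces of the two blocks, so
    measurability follows by composition.\<close>
  have F_eq: "?F = (\<lambda>z. G (restrict z {1..a}) * H (\<lambda>i\<in>{1..b}. z (a + i)))"
    by (intro ext arg_cong2[where f = "(*)"] Gr Hr) auto
  have F: "?F \<in> borel_measurable (M (a + b))"
    unfolding F_eq
    by (intro borel_measurable_times_ennreal measurable_compose[OF r1] measurable_compose[OF r2])
      (use G H in \<open>simp_all add: M_def\<close>)
  have "(\<integral>\<^sup>+z. ?F z \<partial>M (a + b)) = (\<integral>\<^sup>+z. ?F (?s z) \<partial>(M a \<Otimes>\<^sub>M M b))"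
    using nn_integral_distr[OF s, of ?F] F PiM_lborel_append[of a b] by (simp add: M_def)
  also have "\<dots> = (\<integral>\<^sup>+z. G (fst z) * H (snd z) \<partial>(M a \<Otimes>\<^sub>M M b))"
    by (intro nn_integral_cong arg_cong2[where f = "(*)"] Gr Hr)
      (auto simp: case_prod_unfold)
  also have "\<dots> = (\<integral>\<^sup>+x. \<integral>\<^sup>+y. G x * H y \<partial>M b \<partial>M a)"
    by (subst Mb.nn_integral_fst[symmetric]) auto
  also have "\<dots> = (\<integral>\<^sup>+x. G x \<partial>M a) * (\<integral>\<^sup>+y. H y \<partial>M b)"
    by (simp add: nn_integral_cmult nn_integral_multc)
  finally show ?thesis unfolding M_def .
qed

lemma borel_measurable_PiM_lborel_shift:
  fixes F :: "(nat \<Rightarrow> real) \<Rightarrow> 'b::topological_space"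
  assumes F: "F \<in> borel_measurable (Pi\<^sub>M {1..b} (\<lambda>_. lborel))"
    and local: "\<And>x y. (\<And>i. i \<in> {1..b} \<Longrightarrow> x i = y i) \<Longrightarrow> F x = F y"
    and "a + b \<le> m"
  shows "(\<lambda>z. F (\<lambda>i. z (a + i))) \<in> borel_measurable (Pi\<^sub>M {1..m} (\<lambda>_. lborel))"
proof -
  have "(\<lambda>z. \<lambda>i\<in>{1..b}. z (a + i)) \<in>
      measurable (Pi\<^sub>M {1..m} (\<lambda>_. lborel)) (Pi\<^sub>M {1..b} (\<lambda>_. lborel))"
    using assms(3) by (intro measurable_restrict measurable_component_singleton) auto
  from measurable_compose[OF this F]
  show ?thesis
    by (rule back_subst[of "\<lambda>f. f \<in> borel_measurable _"]) (intro ext local, simp)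
qed

text \<open>Induction splits off the last block. The product over the first \<open>k\<close> blocks
  then plays the role of \<open>G\<close> in the two-block lemma, which is why its measurability and
  locality are established first.\<close>

lemma nn_integral_PiM_lborel_blocks:
  fixes n :: "nat \<Rightarrow> nat" and F :: "nat \<Rightarrow> (nat \<Rightarrow> real) \<Rightarrow> ennreal"
  assumes "\<And>j. j < k \<Longrightarrow> F j \<in> borel_measurable (Pi\<^sub>M {1..n j} (\<lambda>_. lborel))"
    and "\<And>j x y. j < k \<Longrightarrow> (\<And>i. i \<in> {1..n j} \<Longrightarrow> x i = y i) \<Longrightarrow> F j x = F j y"
  shows "(\<integral>\<^sup>+z. (\<Prod>j<k. F j (\<lambda>i. z ((\<Sum>m<j. n m) + i))) \<partial>Pi\<^sub>M {1..\<Sum>j<k. n j} (\<lambda>_. lborel)) =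
      (\<Prod>j<k. \<integral>\<^sup>+x. F j x \<partial>Pi\<^sub>M {1..n j} (\<lambda>_. lborel))"
  using assms
proof (induction k)
  case 0
  \<comment> \<open>The product over no coordinates is a one-point space of mass 1, which matches
    the empty product.\<close>
  show ?case by (simp add: PiM_empty)
next
  case (Suc k)
  let ?P = "\<lambda>z. \<Prod>j<k. F j (\<lambda>i. z ((\<Sum>m<j. n m) + i))"
  have le: "(\<Sum>m<j. n m) + n j \<le> (\<Sum>m<k. n m)" if "j < k" for j
    using sum_mono2[of "{..<k}" "{..<Suc j}" n] that by simp
  have meas: "?P \<in> borel_measurable (Pi\<^sub>M {1..\<Sum>j<k. n j} (\<lambda>_. lborel))"
  proof (rule borel_measurable_prod_ennreal)
    fix j assume "j \<in> {..<k}"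
    then have j: "j < k" by simp
    show "(\<lambda>z. F j (\<lambda>i. z ((\<Sum>m<j. n m) + i))) \<in> borel_measurable (Pi\<^sub>M {1..\<Sum>j<k. n j} (\<lambda>_. lborel))"
      by (rule borel_measurable_PiM_lborel_shift[OF Suc.prems(1) Suc.prems(2) le[OF j]]) (use j in simp_all)
  qed
  have cong: "?P x = ?P y" if xy: "\<And>i. i \<in> {1..\<Sum>j<k. n j} \<Longrightarrow> x i = y i" for x y
  proof (rule prod.cong[OF refl])
    fix j assume "j \<in> {..<k}"
    then have j: "j < k" by simp
    have "x ((\<Sum>m<j. n m) + i) = y ((\<Sum>m<j. n m) + i)" if "i \<in> {1..n j}" for i
      using that le[OF j] by (intro xy) simp
    then show "F j (\<lambda>i. x ((\<Sum>m<j. n m) + i)) = F j (\<lambda>i. y ((\<Sum>m<j. n m) + i))"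
      using j by (intro Suc.prems(2)) simp_all
  qed
  have "(\<integral>\<^sup>+z. ?P z * F k (\<lambda>i. z ((\<Sum>m<k. n m) + i)) \<partial>Pi\<^sub>M {1..(\<Sum>j<k. n j) + n k} (\<lambda>_. lborel)) =
    (\<integral>\<^sup>+z. ?P z \<partial>Pi\<^sub>M {1..\<Sum>j<k. n j} (\<lambda>_. lborel)) * (\<integral>\<^sup>+x. F k x \<partial>Pi\<^sub>M {1..n k} (\<lambda>_. lborel))"
    by (rule nn_integral_PiM_lborel_append[OF meas Suc.prems(1)[OF lessI] cong Suc.prems(2)[OF lessI]])
  moreover have "(\<integral>\<^sup>+z. ?P z \<partial>Pi\<^sub>M {1..\<Sum>j<k. n j} (\<lambda>_. lborel)) =
      (\<Prod>j<k. \<integral>\<^sup>+x. F j x \<partial>Pi\<^sub>M {1..n j} (\<lambda>_. lborel))"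
    by (rule Suc.IH[OF Suc.prems(1) Suc.prems(2)]) simp_all
  ultimately show ?case
    by (simp only: prod.lessThan_Suc sum.lessThan_Suc)
qed

section \<open>The exponential integral of a function with homogeneous volume\<close>

text \<open>Here \<open>c\<close> is the measure of the unit ball. It is an \<open>ennreal\<close>,
  so the lemma also applies while the finiteness of that measure is still open, and its finiteness
  can be deduced from the result.\<close>

lemma nn_integral_exp_minus_powr:
  fixes g :: "'a \<Rightarrow> real" and c :: ennreal and p :: real and n :: nat
  assumes "sigma_finite_measure M"
    and g[measurable]: "g \<in> borel_measurable M" and g0: "\<And>x. 0 \<le> g x"
    and "0 < p"
    and vol: "\<And>r. 0 < r \<Longrightarrow> emeasure M {x \<in> space M. g x \<le> r} = ennreal (r ^ n) * c"
  shows "(\<integral>\<^sup>+x. ennreal (exp (- (g x powr p))) \<partial>M) = c * ennreal (Gamma (real n / p + 1))"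
proof -
  interpret M: sigma_finite_measure M by fact
  interpret P: pair_sigma_finite M "lborel :: real measure" ..
  have tail: "ennreal (exp (- y)) = (\<integral>\<^sup>+s. ennreal (exp (- s)) * indicator {y..} s \<partial>lborel)" for y :: real
  proof -
    have "((\<lambda>s::real. - exp (- s)) \<longlongrightarrow> - 0) at_top"
      by (intro tendsto_minus filterlim_compose[OF exp_at_bot filterlim_uminus_at_bot_at_top])
    then have "(\<integral>\<^sup>+s. ennreal (exp (- s)) * indicator {y..} s \<partial>lborel) = ennreal (- 0 - (- exp (- y)))"
      by (intro nn_integral_FTC_atLeast) (auto intro!: derivative_eq_intros)
    then show ?thesis by simp
  qed
  \<comment> \<open>The right-hand side has the shape of the Gamma integrand with argument
    \<open>real n / p + 1\<close>, hence \<open>+ 1 - 1\<close>. The point \<open>s = 0\<close> is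
    excluded because \<open>vol\<close> covers positive radii only; it is a null set.\<close>
  have inner: "(\<integral>\<^sup>+x. ennreal (exp (- s)) * indicator {g x powr p..} s \<partial>M) =
      c * ennreal (indicator {0..} s * s powr (real n / p + 1 - 1) / exp s)" if "s \<noteq> 0" for s :: real
  proof (cases "s > 0")
    case True
    have iff: "g x powr p \<le> s \<longleftrightarrow> g x \<le> s powr (1 / p)" for x
    proof -
      have "g x powr p \<le> s \<longleftrightarrow> g x powr p \<le> (s powr (1 / p)) powr p"
        using True \<open>0 < p\<close> by (simp add: powr_powr)
      also have "\<dots> \<longleftrightarrow> g x \<le> s powr (1 / p)"
        using True \<open>0 < p\<close> g0[of x] powr_mono2[of p "g x" "s powr (1 / p)"]
          powr_less_mono2[of p "s powr (1 / p)" "g x"] by (auto simp: not_less[symmetric])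
      finally show ?thesis .
    qed
    have "(\<integral>\<^sup>+x. ennreal (exp (- s)) * indicator {g x powr p..} s \<partial>M) =
        (\<integral>\<^sup>+x. ennreal (exp (- s)) * indicator {x \<in> space M. g x \<le> s powr (1 / p)} x \<partial>M)"
      by (intro nn_integral_cong) (auto simp: indicator_def iff)
    also have "\<dots> = ennreal (exp (- s)) * (ennreal ((s powr (1 / p)) ^ n) * c)"
      using True by (simp add: nn_integral_cmult vol)
    also have "(s powr (1 / p)) ^ n = s powr (real n / p)"
      using True by (simp add: powr_powr flip: powr_realpow)
    finally show ?thesis
      using True by (simp add: exp_minus divide_inverse ennreal_mult mult_ac)
  next
    case False
    then have "\<not> g x powr p \<le> s" for x
      using that powr_ge_zero[of "g x" p] by linarith
    then show ?thesis using False that by simp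
  qed
  have "(\<integral>\<^sup>+x. ennreal (exp (- (g x powr p))) \<partial>M) =
      (\<integral>\<^sup>+x. \<integral>\<^sup>+s. ennreal (exp (- s)) * indicator {g x powr p..} s \<partial>lborel \<partial>M)"
    by (intro nn_integral_cong tail)
  also have "\<dots> = (\<integral>\<^sup>+s. \<integral>\<^sup>+x. ennreal (exp (- s)) * indicator {g x powr p..} s \<partial>M \<partial>lborel)"
  \<comment> \<open>Exchanging the integrals requires joint measurability, which comes from the
    measurable region \<open>g x powr p \<le> s\<close> in the product space.\<close>
  proof (rule P.Fubini'[symmetric])
    have "{z \<in> space (M \<Otimes>\<^sub>M lborel). g (fst z) powr p \<le> snd z} \<in> sets (M \<Otimes>\<^sub>M lborel)" (is "?S \<in> _")
      by measurable
    then have "(\<lambda>z. ennreal (exp (- snd z)) * indicator ?S z) \<in> borel_measurable (M \<Otimes>\<^sub>M lborel)"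
      by measurable
    then show "(\<lambda>(x, s). ennreal (exp (- s)) * indicator {g x powr p..} s) \<in> borel_measurable (M \<Otimes>\<^sub>M lborel)"
      by (rule measurable_cong[THEN iffD1, rotated])
        (simp add: indicator_def space_pair_measure case_prod_unfold)
  qed
  also have "\<dots> = (\<integral>\<^sup>+s. c * ennreal (indicator {0..} s * s powr (real n / p + 1 - 1) / exp s) \<partial>lborel)"
    by (intro nn_integral_cong_AE eventually_mono[OF AE_lborel_singleton[of 0]] inner)
  also have "\<dots> = c * ennreal (Gamma (real n / p + 1))"
    using \<open>0 < p\<close> by (subst nn_integral_cmult) (simp_all add: Gamma_conv_nn_integral_real add_nonneg_pos)
  finally show ?thesis .
qed

section \<open>Locality, homogeneity and measurability of nested functions\<close>

lemma lp_nested_nonneg: "0 \<le> lp_nested T x"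
  by (cases T) auto

lemma n_leaves_pos: "wf_lp_tree T \<Longrightarrow> 0 < n_leaves T"
proof (induction T)
  case (Node p ts)
  then obtain t ts' where "ts = t # ts'" by (cases ts) auto
  with Node show ?case by auto
qed simp

lemma n_leaves_Node: "n_leaves (Node p ts) = (\<Sum>k<length ts. n_leaves (ts ! k))"
  by (simp add: sum_list_sum_nth atLeast0LessThan)

lemma n_leaves_prefix_le:
  assumes "k < length ts"
  shows "(\<Sum>j<k. n_leaves (ts ! j)) + n_leaves (ts ! k) \<le> n_leaves (Node p ts)"
  unfolding n_leaves_Node
  using sum_mono2[of "{..<length ts}" "{..<Suc k}" "\<lambda>j. n_leaves (ts ! j)"] assms by simp

text \<open>This is the locality required by the block lemmas: each child reads its own block, which
  ends within the leaves of the whole tree.\<close>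

lemma lp_nested_cong:
  "(\<And>i. i \<in> {1..n_leaves T} \<Longrightarrow> x i = y i) \<Longrightarrow> lp_nested T x = lp_nested T y"
proof (induction T arbitrary: x y)
  case (Node p ts)
  have "lp_nested (ts ! k) (\<lambda>i. x ((\<Sum>j<k. n_leaves (ts ! j)) + i)) =
      lp_nested (ts ! k) (\<lambda>i. y ((\<Sum>j<k. n_leaves (ts ! j)) + i))" if "k < length ts" for k
    using that n_leaves_prefix_le[OF that, of p]
    by (intro Node.IH Node.prems) auto
  then show ?case
    by (auto intro!: sum.cong arg_cong[where f = "\<lambda>s. s powr (1 / p)"])
qed auto

lemma lp_nested_scale:
  assumes "0 < c"
  shows "wf_lp_tree T \<Longrightarrow> lp_nested T (\<lambda>i. c * x i) = c * lp_nested T x"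
proof (induction T arbitrary: x)
  case Leaf
  then show ?case using assms by (simp add: abs_mult)
next
  case (Node p ts)
  have "lp_nested (Node p ts) (\<lambda>i. c * x i) =
      (\<Sum>k<length ts. c powr p * lp_nested (ts ! k) (\<lambda>i. x ((\<Sum>j<k. n_leaves (ts ! j)) + i)) powr p) powr (1 / p)"
    using Node assms
    by (auto simp: list_all_length powr_mult lp_nested_nonneg intro!: sum.cong arg_cong[where f = "\<lambda>s. s powr (1 / p)"])
  also have "\<dots> = c * lp_nested (Node p ts) x"
    using Node.prems assms by (simp flip: sum_distrib_left add: powr_mult powr_powr sum_nonneg)
  finally show ?case .
qed

lemma borel_measurable_lp_nested:
  "lp_nested T \<in> borel_measurable (Pi\<^sub>M {1..n_leaves T} (\<lambda>_. lborel))"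
proof (induction T)
  case Leaf
  have "(\<lambda>x. x 1) \<in> measurable (Pi\<^sub>M {1..n_leaves Leaf} (\<lambda>_. lborel :: real measure)) lborel"
    by (rule measurable_component_singleton) simp
  then show ?case by simp
next
  case (Node p ts)
  have "(\<lambda>x. lp_nested (ts ! k) (\<lambda>i. x ((\<Sum>j<k. n_leaves (ts ! j)) + i))) \<in>
      borel_measurable (Pi\<^sub>M {1..n_leaves (Node p ts)} (\<lambda>_. lborel))" if "k < length ts" for k
    by (rule borel_measurable_PiM_lborel_shift[OF Node.IH lp_nested_cong n_leaves_prefix_le])
      (use that in auto)
  then have [measurable]: "(\<lambda>x. lp_nested (ts ! k) (\<lambda>i. x ((\<Sum>j<k. n_leaves (ts ! j)) + i))) \<in>
      borel_measurable (Pi\<^sub>M {1..n_leaves (Node p ts)} (\<lambda>_. lborel))" if "k \<in> {..<length ts}" for k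
    using that by blast
  have "(\<lambda>x. (\<Sum>k<length ts. lp_nested (ts ! k) (\<lambda>i. x ((\<Sum>j<k. n_leaves (ts ! j)) + i)) powr p) powr (1 / p))
      \<in> borel_measurable (Pi\<^sub>M {1..n_leaves (Node p ts)} (\<lambda>_. lborel))"
    by measurable
  then show ?case by (simp del: n_leaves.simps)
qed

text \<open>By homogeneity the dilation by \<open>r\<close> pulls the ball of radius
  \<open>r\<close> back to the unit ball. The equation is stated in \<open>ennreal\<close> because
  finiteness is not yet available.\<close>

lemma emeasure_lp_ball_scale:
  assumes "wf_lp_tree T" and "0 < r"
  defines "M \<equiv> Pi\<^sub>M {1..n_leaves T} (\<lambda>_. lborel :: real measure)"
  shows "emeasure M {x \<in> space M. lp_nested T x \<le> r} =
    ennreal (r ^ n_leaves T) * emeasure M {x \<in> space M. lp_nested T x \<le> 1}"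
proof -
  have [measurable]: "lp_nested T \<in> borel_measurable M"
    unfolding M_def by (rule borel_measurable_lp_nested)
  let ?s = "\<lambda>x. \<lambda>i\<in>{1..n_leaves T}. r * x i :: real"
  have s: "?s \<in> measurable M M"
    unfolding M_def by measurable
  have "lp_nested T (?s x) = r * lp_nested T x" for x
    using lp_nested_scale[OF assms(2,1), of x] lp_nested_cong[of T "?s x" "\<lambda>i. r * x i"] by simp
  then have pre: "?s -` {x \<in> space M. lp_nested T x \<le> r} \<inter> space M = {x \<in> space M. lp_nested T x \<le> 1}"
    using assms(2) measurable_space[OF s] by auto
  have ball: "{x \<in> space M. lp_nested T x \<le> r} \<in> sets M"
    by measurable
  have "emeasure M {x \<in> space M. lp_nested T x \<le> r} =
      emeasure (scale_measure (ennreal (r ^ n_leaves T)) (distr M M ?s)) {x \<in> space M. lp_nested T x \<le> r}"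
    using PiM_lborel_scale[of "{1..n_leaves T}" r] assms(2) by (simp add: M_def)
  then show ?thesis
    by (simp only: emeasure_scale_measure emeasure_distr[OF s ball] pre)
qed

section \<open>The product over the inner nodes and its recursion at the root\<close>

definition lp_factor :: "lp_tree \<Rightarrow> nat list \<Rightarrow> real" where
  "lp_factor T I = (\<Prod>k=1..node_arity T I. Gamma (real (node_leaves T (I @ [k])) / node_exponent T I)) /
     (node_exponent T I ^ (node_arity T I - 1) * Gamma (real (node_leaves T I) / node_exponent T I))"

text \<open>For a well-formed tree this is the surface of the unit sphere, that is, the volume of
  the unit ball times the number of leaves. This normalization makes the recursion at the root free
  of leaf-count denominators.\<close>

definition lp_coeff :: "lp_tree \<Rightarrow> real" where
  "lp_coeff T = 2 ^ n_leaves T * (\<Prod>I\<in>inner_nodes T. lp_factor T I)"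

lemma inner_nodes_Leaf: "inner_nodes Leaf = {}"
proof -
  have "subtree Leaf I = Leaf" for I by (cases I) auto
  then show ?thesis by (simp add: inner_nodes_def)
qed

text \<open>Multi-indices number children from 1 and lists from 0, so the paths through
  \<open>ts ! k\<close> begin with \<open>Suc k\<close>.\<close>

lemma inner_nodes_Node:
  "inner_nodes (Node p ts) = insert [] (\<Union>k<length ts. (#) (Suc k) ` inner_nodes (ts ! k))"
proof (intro set_eqI iffI)
  fix I assume I: "I \<in> inner_nodes (Node p ts)"
  show "I \<in> insert [] (\<Union>k<length ts. (#) (Suc k) ` inner_nodes (ts ! k))"
  proof (cases I)
    case (Cons m J)
    then have m: "1 \<le> m" "m \<le> length ts" "J \<in> inner_nodes (ts ! (m - 1))"
      using I by (auto simp: inner_nodes_def split: if_splits)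
    then have "I \<in> (#) (Suc (m - 1)) ` inner_nodes (ts ! (m - 1))" "m - 1 < length ts"
      using Cons by auto
    then show ?thesis by blast
  qed simp
qed (auto simp: inner_nodes_def)

text \<open>Paths through different children differ in their first entry, and none of them is
  \<open>[]\<close>, so the union is disjoint.\<close>

lemma prod_inner_nodes_Node:
  fixes g :: "nat list \<Rightarrow> 'a::comm_monoid_mult"
  shows "(\<Prod>I\<in>inner_nodes (Node p ts). g I) =
    g [] * (\<Prod>k<length ts. \<Prod>I\<in>inner_nodes (ts ! k). g (Suc k # I))"
proof -
  have "(\<Prod>I\<in>inner_nodes (Node p ts). g I) =
      g [] * (\<Prod>I\<in>(\<Union>k<length ts. (#) (Suc k) ` inner_nodes (ts ! k)). g I)"
    unfolding inner_nodes_Node using finite_inner_nodes by (subst prod.insert) auto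
  also have "(\<Prod>I\<in>(\<Union>k<length ts. (#) (Suc k) ` inner_nodes (ts ! k)). g I) =
      (\<Prod>k<length ts. \<Prod>I\<in>(#) (Suc k) ` inner_nodes (ts ! k). g I)"
    using finite_inner_nodes by (intro prod.UNION_disjoint) auto
  also have "\<dots> = (\<Prod>k<length ts. \<Prod>I\<in>inner_nodes (ts ! k). g (Suc k # I))"
    by (rule prod.cong[OF refl]) (simp add: prod.reindex)
  finally show ?thesis .
qed

lemma lp_factor_Cons:
  assumes "k < length ts"
  shows "lp_factor (Node p ts) (Suc k # I) = lp_factor (ts ! k) I"
  using assms by (simp add: lp_factor_def node_arity_def node_leaves_def node_exponent_def)

lemma lp_factor_Nil:
  "lp_factor (Node p ts) [] = (\<Prod>k<length ts. Gamma (real (n_leaves (ts ! k)) / p)) /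
    (p ^ (length ts - 1) * Gamma (real (n_leaves (Node p ts)) / p))"
proof -
  have "(\<Prod>k=1..length ts. Gamma (real (node_leaves (Node p ts) [k]) / p)) =
      (\<Prod>k<length ts. Gamma (real (n_leaves (ts ! k)) / p))"
    by (rule prod.reindex_bij_witness[of _ Suc "\<lambda>k. k - 1"]) (auto simp: node_leaves_def)
  then show ?thesis
    by (simp add: lp_factor_def node_arity_def node_exponent_def node_leaves_def)
qed

text \<open>The power of 2 is distributed over the children because their leaf counts add up to that
  of the root.\<close>

lemma lp_coeff_Node:
  "lp_coeff (Node p ts) = (\<Prod>k<length ts. lp_coeff (ts ! k) * Gamma (real (n_leaves (ts ! k)) / p)) /
    (p ^ (length ts - 1) * Gamma (real (n_leaves (Node p ts)) / p))"
  by (simp add: lp_coeff_def prod_inner_nodes_Node lp_factor_Nil lp_factor_Cons prod.distrib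
      n_leaves_Node power_sum mult_ac del: n_leaves.simps(2))

lemma lp_coeff_nonneg: "wf_lp_tree T \<Longrightarrow> 0 \<le> lp_coeff T"
proof (induction T)
  case Leaf
  show ?case by (simp add: lp_coeff_def inner_nodes_Leaf)
next
  case (Node p ts)
  have "0 < real (n_leaves (Node p ts)) / p"
    using Node.prems n_leaves_pos[OF Node.prems] by simp
  moreover have "0 < real (n_leaves (ts ! k)) / p" if "k < length ts" for k
    using Node.prems n_leaves_pos that by (simp add: list_all_length)
  ultimately show ?case
    unfolding lp_coeff_Node using Node
    by (intro divide_nonneg_nonneg mult_nonneg_nonneg prod_nonneg zero_le_power
        less_imp_le[OF Gamma_real_pos]) (auto simp: list_all_length)
qed

section \<open>Volume of the ball by induction on the tree\<close>

text \<open>The radius is kept arbitrary in the induction because the exponential integral over a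
  child uses the volumes of its balls of all positive radii.\<close>

lemma emeasure_lp_ball:
  "wf_lp_tree T \<Longrightarrow> 0 < r \<Longrightarrow>
    emeasure (Pi\<^sub>M {1..n_leaves T} (\<lambda>_. lborel)) {x \<in> space (Pi\<^sub>M {1..n_leaves T} (\<lambda>_. lborel)). lp_nested T x \<le> r} =
    ennreal (lp_coeff T / real (n_leaves T) * r ^ n_leaves T)"
proof (induction T arbitrary: r)
  case Leaf
  have abs_le: "\<bar>y\<bar> \<le> r \<longleftrightarrow> y \<in> {- r..r}" for y :: real
    by auto
  have eq: "{x \<in> space (Pi\<^sub>M {1..n_leaves Leaf} (\<lambda>_. lborel :: real measure)). lp_nested Leaf x \<le> r} =
      Pi\<^sub>E {1} (\<lambda>_. {- r..r})"
    by (simp add: space_PiM PiE_def Pi_def abs_le set_eq_iff conj_commute)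
  show ?case
    unfolding eq using Leaf.prems
    using lborel_product.emeasure_PiM[of "{1}" "\<lambda>_. {- r..r}"]
    by (simp add: lp_coeff_def inner_nodes_Leaf)
next
  case (Node p ts)
  let ?T = "Node p ts"
  let ?M = "\<lambda>n. Pi\<^sub>M {1..n} (\<lambda>_. lborel :: real measure)"
  let ?n = "\<lambda>k. n_leaves (ts ! k)"
  define N where "N = n_leaves ?T"
  define \<mu> where "\<mu> = emeasure (?M N) {x \<in> space (?M N). lp_nested ?T x \<le> 1}"
  define G where "G = (\<Prod>k<length ts. lp_coeff (ts ! k) * Gamma (real (?n k) / p))"
  have p: "0 < p" and len: "2 \<le> length ts" and wf: "\<And>k. k < length ts \<Longrightarrow> wf_lp_tree (ts ! k)"
    using Node.prems(1) by (auto simp: list_all_length)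
  have npos: "0 < N" "\<And>k. k < length ts \<Longrightarrow> 0 < ?n k"
    unfolding N_def by (intro n_leaves_pos Node.prems(1) wf, assumption?)+
  \<comment> \<open>The factor \<open>real k / p\<close> cancels the leaf count in the denominator
    of a ball volume and leaves \<open>1 / p\<close>.\<close>
  have Gamma_Suc: "Gamma (real k / p + 1) = real k / p * Gamma (real k / p)" if "0 < k" for k
  proof (rule Gamma_plus1)
    have "0 < real k / p" using that p by simp
    then show "real k / p \<notin> \<int>\<^sub>\<le>\<^sub>0" by (meson nonpos_Ints_nonpos not_less)
  qed
  have nonneg: "0 \<le> lp_coeff (ts ! k) * Gamma (real (?n k) / p)" if "k < length ts" for k
    using lp_coeff_nonneg wf npos(2) p that
    by (intro mult_nonneg_nonneg less_imp_le[OF Gamma_real_pos]) simp_all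
  \<comment> \<open>Raising to the exponent of the root removes its outer power
    \<open>1 / p\<close>, and the exponential turns the remaining sum into a product.\<close>
  have exp_eq: "ennreal (exp (- (lp_nested ?T x powr p))) =
      (\<Prod>k<length ts. ennreal (exp (- (lp_nested (ts ! k) (\<lambda>i. x ((\<Sum>j<k. ?n j) + i)) powr p))))" for x
  proof -
    have "lp_nested ?T x powr p = (\<Sum>k<length ts. lp_nested (ts ! k) (\<lambda>i. x ((\<Sum>j<k. ?n j) + i)) powr p)"
      using p by (simp add: powr_powr sum_nonneg)
    then show ?thesis
      by (simp add: prod_ennreal exp_sum del: lp_nested.simps flip: sum_negf)
  qed
  \<comment> \<open>The exponent is that of the parent, not that of the child; this is why the
    exponential integral was computed for every positive exponent.\<close>
  have child: "(\<integral>\<^sup>+x. ennreal (exp (- (lp_nested (ts ! k) x powr p))) \<partial>?M (?n k)) =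
      ennreal (lp_coeff (ts ! k) * Gamma (real (?n k) / p) / p)" if k: "k < length ts" for k
  proof -
    have pos: "0 \<le> lp_coeff (ts ! k)" "0 < ?n k"
      using lp_coeff_nonneg wf[OF k] npos(2)[OF k] by auto
    have "(\<integral>\<^sup>+x. ennreal (exp (- (lp_nested (ts ! k) x powr p))) \<partial>?M (?n k)) =
        ennreal (lp_coeff (ts ! k) / real (?n k)) * ennreal (Gamma (real (?n k) / p + 1))"
      using Node.IH[OF nth_mem[OF k] wf[OF k]] p pos
      by (intro nn_integral_exp_minus_powr lborel_product.sigma_finite borel_measurable_lp_nested
          lp_nested_nonneg) (auto simp: mult.commute simp flip: ennreal_mult)
    also have "\<dots> = ennreal (lp_coeff (ts ! k) * Gamma (real (?n k) / p) / p)"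
      using pos by (simp add: Gamma_Suc flip: ennreal_mult')
    finally show ?thesis .
  qed
  have "\<mu> * ennreal (Gamma (real N / p + 1)) =
      (\<integral>\<^sup>+x. ennreal (exp (- (lp_nested ?T x powr p))) \<partial>?M N)"
    unfolding \<mu>_def N_def
    by (rule nn_integral_exp_minus_powr[OF lborel_product.sigma_finite borel_measurable_lp_nested
          lp_nested_nonneg p emeasure_lp_ball_scale[OF Node.prems(1)], symmetric]) simp_all
  also have "\<dots> = (\<Prod>k<length ts. \<integral>\<^sup>+x. ennreal (exp (- (lp_nested (ts ! k) x powr p))) \<partial>?M (?n k))"
    unfolding exp_eq N_def n_leaves_Node
  proof (rule nn_integral_PiM_lborel_blocks)
    fix k assume "k < length ts"
    have [measurable]: "lp_nested (ts ! k) \<in> borel_measurable (?M (?n k))"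
      by (rule borel_measurable_lp_nested)
    show "(\<lambda>x. ennreal (exp (- (lp_nested (ts ! k) x powr p)))) \<in> borel_measurable (?M (?n k))"
      by measurable
    show "ennreal (exp (- (lp_nested (ts ! k) x powr p))) = ennreal (exp (- (lp_nested (ts ! k) y powr p)))"
      if "\<And>i. i \<in> {1..?n k} \<Longrightarrow> x i = y i" for x y
      using lp_nested_cong[of "ts ! k", OF that] by simp
  qed
  also have "\<dots> = (\<Prod>k<length ts. ennreal (lp_coeff (ts ! k) * Gamma (real (?n k) / p) / p))"
    by (intro prod.cong child) simp_all
  also have "\<dots> = ennreal (G / p ^ length ts)"
    using p by (subst prod_ennreal) (auto intro!: divide_nonneg_pos nonneg simp: G_def prod_dividef)
  finally have eq: "\<mu> * ennreal (Gamma (real N / p + 1)) = ennreal (G / p ^ length ts)" .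
  have Gpos: "0 < Gamma (real N / p + 1)"
    using p by (intro Gamma_real_pos) (simp add: add_nonneg_pos)
  have "\<mu> = ennreal (G / p ^ length ts / Gamma (real N / p + 1))"
  \<comment> \<open>An infinite \<open>\<mu>\<close> would make the left-hand side of
    \<open>eq\<close> infinite, since the Gamma value is positive, whereas the right-hand side is
    finite.\<close>
  proof (cases \<mu>)
    case (real m)
    have "0 \<le> G"
      unfolding G_def using nonneg by (intro prod_nonneg) simp
    with real eq Gpos p have "m * Gamma (real N / p + 1) = G / p ^ length ts"
      by (simp flip: ennreal_mult)
    then have "m = G / p ^ length ts / Gamma (real N / p + 1)"
      using Gpos by (subst nonzero_eq_divide_eq) simp_all
    with real show ?thesis by simp
  qed (use eq Gpos in \<open>simp add: ennreal_top_mult\<close>)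
  also have "G / p ^ length ts / Gamma (real N / p + 1) = lp_coeff ?T / real N"
  proof -
    \<comment> \<open>Each child supplies one factor \<open>1 / p\<close>, and the Gamma recursion
      for the root cancels one of them, which leaves the exponent
      \<open>length ts - 1\<close>.\<close>
    have "p ^ length ts = p * p ^ (length ts - 1)"
      using len by (cases "length ts") simp_all
    then show ?thesis
      using p npos(1)
      by (simp add: Gamma_Suc lp_coeff_Node G_def N_def[symmetric] del: n_leaves.simps)
  qed
  finally have "\<mu> = ennreal (lp_coeff ?T / real N)" .
  then show ?case
    using emeasure_lp_ball_scale[OF Node.prems] Node.prems(2)
    by (simp add: \<mu>_def N_def mult.commute del: n_leaves.simps lp_nested.simps flip: ennreal_mult')
qed

section \<open>From the Gamma form to the Beta form\<close>

text \<open>The Gamma value of each partial sum is the denominator of one Beta factor and a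
  numerator of the next. Only \<open>Gamma (a 1)\<close>, the values at the later terms and the
  Gamma value of the total sum survive. Positivity makes the cancelled values nonzero.\<close>

lemma prod_Beta_eq_prod_Gamma:
  fixes a :: "nat \<Rightarrow> real"
  assumes "\<And>k. k \<in> {1..Suc m} \<Longrightarrow> 0 < a k"
  shows "(\<Prod>k=1..m. Beta (\<Sum>i=1..k. a i) (a (k + 1))) =
    (\<Prod>k=1..Suc m. Gamma (a k)) / Gamma (\<Sum>k=1..Suc m. a k)"
  using assms
proof (induction m)
  case 0
  then have "0 < a 1" by simp
  from Gamma_real_pos[OF this] show ?case by simp
next
  case (Suc m)
  have "0 < (\<Sum>k=1..Suc m. a k)"
    using Suc.prems by (intro sum_pos) auto
  from Gamma_real_pos[OF this] have "Gamma (\<Sum>k=1..Suc m. a k) \<noteq> 0"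
    by linarith
  with Suc show ?case
    by (simp add: Beta_def)
qed

lemma subtree_append: "subtree T (I @ J) = subtree (subtree T I) J"
proof (induction T I rule: subtree.induct)
  case (2 T k I)
  have "subtree Leaf J = Leaf" by (cases J) auto
  then show ?case using 2 by auto
qed simp

lemma wf_subtree: "wf_lp_tree T \<Longrightarrow> wf_lp_tree (subtree T I)"
proof (induction T I rule: subtree.induct)
  case (2 T k I)
  then show ?case by (cases T) (auto simp: list_all_length)
qed simp

text \<open>The telescoping product is applied to the leaf counts of the children divided by the
  exponent of \<open>I\<close>; their sum is the leaf count of \<open>I\<close> over the same
  exponent.\<close>

lemma lp_factor_conv_Beta:
  assumes "wf_lp_tree T" and "I \<in> inner_nodes T"
  shows "1 / node_exponent T I ^ (node_arity T I - 1) *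
      (\<Prod>k=1..node_arity T I - 1.
        Beta ((\<Sum>i=1..k. real (node_leaves T (I @ [i]))) / node_exponent T I)
          (real (node_leaves T (I @ [k + 1])) / node_exponent T I)) = lp_factor T I"
proof -
  obtain p ts where sub: "subtree T I = Node p ts"
    using assms(2) by (cases "subtree T I") (auto simp: inner_nodes_def)
  have wf: "wf_lp_tree (Node p ts)"
    using wf_subtree[OF assms(1), of I] sub by simp
  obtain m where m: "length ts = Suc m"
    using wf by (cases "length ts") auto
  define a where "a = (\<lambda>k. real (node_leaves T (I @ [k])) / p)"
  have leaves: "node_leaves T (I @ [k]) = n_leaves (ts ! (k - 1))" if "k \<in> {1..Suc m}" for k
    using that sub m by (simp add: node_leaves_def subtree_append)
  have "0 < a k" if "k \<in> {1..Suc m}" for k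
    using that wf m leaves[OF that]
    by (auto simp: a_def list_all_length intro!: divide_pos_pos n_leaves_pos)
  note B = prod_Beta_eq_prod_Gamma[of m a, OF this]
  have "(\<Sum>k=1..Suc m. real (node_leaves T (I @ [k]))) = real (n_leaves (Node p ts))"
    unfolding n_leaves_Node m of_nat_sum
    by (rule sum.reindex_bij_witness[of _ Suc "\<lambda>k. k - 1"]) (auto simp: leaves)
  then have "(\<Sum>k=1..Suc m. a k) = real (n_leaves (Node p ts)) / p"
    by (simp only: a_def flip: sum_divide_distrib)
  with B show ?thesis
    by (simp add: lp_factor_def node_exponent_def node_arity_def node_leaves_def[of T I] sub m a_def
        sum_divide_distrib del: n_leaves.simps prod.cl_ivl_Suc sum.cl_ivl_Suc)
qed

section \<open>Volume and surface as real functions of the radius\<close>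

lemma lp_volume_eq:
  assumes "wf_lp_tree T" and "0 < r"
  shows "lp_volume (n_leaves T) (lp_nested T) r = lp_coeff T / real (n_leaves T) * r ^ n_leaves T"
  using emeasure_lp_ball[OF assms] lp_coeff_nonneg[OF assms(1)] assms(2)
  by (simp add: lp_volume_def measure_def)

text \<open>The monomial formula is established for positive radii only, so it is differentiated on
  the open half-line around \<open>r\<close>.\<close>

lemma DERIV_lp_volume:
  assumes "wf_lp_tree T" and "0 < r"
  shows "(lp_volume (n_leaves T) (lp_nested T) has_field_derivative lp_coeff T * r ^ (n_leaves T - 1)) (at r)"
proof (rule has_field_derivative_transform_within_open[of "\<lambda>r. lp_coeff T / real (n_leaves T) * r ^ n_leaves T" _ _ "{0<..}"])
  show "((\<lambda>r. lp_coeff T / real (n_leaves T) * r ^ n_leaves T) has_field_derivative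
      lp_coeff T * r ^ (n_leaves T - 1)) (at r)"
    using n_leaves_pos[OF assms(1)] by (auto intro!: derivative_eq_intros)
qed (use assms in \<open>auto simp: lp_volume_eq\<close>)

theorem proposition2:
  fixes T :: lp_tree and f :: "(nat \<Rightarrow> real) \<Rightarrow> real" and n :: nat and R :: real
  assumes "wf_lp_tree T"
    and "f = lp_nested T"
    and "n = n_leaves T"
    and "2 \<le> n"
    and "0 < R"
  shows "lp_volume n f R = R ^ n * 2 ^ n / real n *
      (\<Prod>I\<in>inner_nodes T. 1 / node_exponent T I ^ (node_arity T I - 1) *
        (\<Prod>k=1..node_arity T I - 1.
          Beta ((\<Sum>i=1..k. real (node_leaves T (I @ [i]))) / node_exponent T I)
               (real (node_leaves T (I @ [k + 1])) / node_exponent T I))) \<and>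
    lp_volume n f R = R ^ n * 2 ^ n / real n *
      (\<Prod>I\<in>inner_nodes T.
        (\<Prod>k=1..node_arity T I. Gamma (real (node_leaves T (I @ [k])) / node_exponent T I)) /
        (node_exponent T I ^ (node_arity T I - 1) *
          Gamma (real (node_leaves T I) / node_exponent T I))) \<and>
    lp_volume n f differentiable (at R) \<and>
    lp_surface n f R = R ^ (n - 1) * 2 ^ n *
      (\<Prod>I\<in>inner_nodes T. 1 / node_exponent T I ^ (node_arity T I - 1) *
        (\<Prod>k=1..node_arity T I - 1.
          Beta ((\<Sum>i=1..k. real (node_leaves T (I @ [i]))) / node_exponent T I)
               (real (node_leaves T (I @ [k + 1])) / node_exponent T I))) \<and>
    lp_surface n f R = R ^ (n - 1) * 2 ^ n *
      (\<Prod>I\<in>inner_nodes T.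
        (\<Prod>k=1..node_arity T I. Gamma (real (node_leaves T (I @ [k])) / node_exponent T I)) /
        (node_exponent T I ^ (node_arity T I - 1) *
          Gamma (real (node_leaves T I) / node_exponent T I)))"

proof -
  let ?P = "\<Prod>I\<in>inner_nodes T. lp_factor T I"
  have Beta: "(\<Prod>I\<in>inner_nodes T. 1 / node_exponent T I ^ (node_arity T I - 1) *
        (\<Prod>k=1..node_arity T I - 1.
          Beta ((\<Sum>i=1..k. real (node_leaves T (I @ [i]))) / node_exponent T I)
               (real (node_leaves T (I @ [k + 1])) / node_exponent T I))) = ?P"
    using lp_factor_conv_Beta[OF assms(1)] by (intro prod.cong refl) blast
  have deriv: "(lp_volume n f has_field_derivative lp_coeff T * R ^ (n - 1)) (at R)"
    using DERIV_lp_volume assms by simp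
  have vol: "lp_volume n f R = R ^ n * 2 ^ n / real n * ?P"
    using lp_volume_eq assms by (simp add: lp_coeff_def)
  have "lp_surface n f R = R ^ (n - 1) * 2 ^ n * ?P"
    using DERIV_imp_deriv[OF deriv] assms(3) by (simp add: lp_surface_def lp_coeff_def)
  \<comment> \<open>\<open>deriv\<close> returns some value even where no derivative exists; this
    conjunct certifies that the surface is a genuine derivative.\<close>
  moreover have "lp_volume n f differentiable (at R)"
    using deriv real_differentiable_def by blast
  ultimately show ?thesis
    unfolding Beta using vol by (simp only: lp_factor_def[abs_def] simp_thms)
qed
end
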